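(* Let $k_1,k_2\ge1$ be integers. For all $n\ge\min(k_1,k_2)$, $$P_{q,\theta}(\widehat W_S=n)=\widehat P^{(1)}_{q,S}(n)+\widehat P^{(0)}_{q,S}(n),$$ where $\widehat P^{(1)}_{q,S}(k_1)=\theta^{k_1}$, $\widehat P^{(0)}_{q,S}(k_2)=\prod_{j=1}^{k_2}(1-\theta q^{j-1})$, for $n>k_1$ $$\widehat P^{(1)}_{q,S}(n)=\theta^{k_1}\prod_{j=1}^{n-k_1}(1-\theta q^{j-1})\sum_{s=1}^{k_1}\Big[\overline H_{q,0,0}^{\infty,k_2}(k_1,n-k_1,s)+\overline G_{q,0,0}^{\infty,k_2}(k_1,n-k_1,s)\Big],$$ and for $n>k_2$ $$\widehat P^{(0)}_{q,S}(n)=\sum_{i=1}^{\min(n-k_2,k_1-1)}\theta^{i}\prod_{j=1}^{n-i}(1-\theta q^{j-1})\sum_{s=1}^{i}\Big[\overline G_{q,0,0}^{\infty,k_2}(i,n-k_2-i,s)+\overline H_{q,0,0}^{\infty,k_2}(i,n-k_2-i,s)\Big].$$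
   Context: Model: fix reals $0\le\theta\le1$ and $0<q<1$. $(X_j)_{j\ge1}$ is a sequence of $\{0,1\}$-valued random variables (1 = success, 0 = failure) with law $P_{q,\theta}$ such that, conditionally on $X_1,\dots,X_{j-1}$ containing exactly $i-1$ zeros, $X_j=0$ with probability $1-\theta q^{i-1}$ and $X_j=1$ with probability $\theta q^{i-1}$. Conventions: $0^0=1$, empty products are 1, empty sums are 0. Waiting times: $N_1$ is the trial at which the $k_1$-th success (in total) occurs; $T_0$ is the least $n\ge k_2$ with $X_{n-k_2+1}=\dots=X_n=0$ ($\infty$ if it does not occur). $\widehat W_S=\min(N_1,T_0)$ (frequency quota on successes, run quota on failures, sooner case); $\widehat P^{(1)}_{q,S}(n)=P_{q,\theta}(N_1=n,\ T_0>n)$ and $\widehat P^{(0)}_{q,S}(n)=P_{q,\theta}(T_0=n,\ N_1>n)$. Combinatorial sums, for integers $u,v$ and $s\ge1$, all variables being positive integers (a family of zero variables consists of the single empty tuple, with sum $0$): - $\overline G_{q,0,0}^{\infty,k_2}(u,v,s)=\sum q^{\sum_{j=2}^{s}(y_1+\dots+y_{j-1})x_j}$ over $(x_1,\dots,x_s)$ with $\sum x_j=u$ and $(y_1,\dots,y_{s-1})$ with $\sum y_j=v$, all $y_j<k_2$; - $\overline H_{q,0,0}^{\infty,k_2}(u,v,s)=\sum q^{\sum_{j=1}^{s}(y_1+\dots+y_j)x_j}$ over $(x_1,\dots,x_s)$ with $\sum x_j=u$ and $(y_1,\dots,y_s)$ with $\sum y_j=v$, all $y_j<k_2$. *)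

theory Defs
  imports "HOL-Probability.Probability" "HOL-Library.Extended_Nat"
begin

text \<open>
  Trials are indexed by \<open>j \<ge> 1\<close>; the value of a sequence at index 0 is irrelevant everywhere.
  Outcome 1 is a success, outcome 0 a failure.

  The conditioning is on the whole history \<open>X 1, \<dots>, X (j - 1)\<close>, of which only the number of
  zeros enters the success probability. Histories of probability zero (they occur for
  \<open>\<theta> = 0\<close> and \<open>\<theta> = 1\<close>) impose no condition.
\<close>

locale q_geometric_trials = prob_space M for M :: "'a measure" +
  fixes q \<theta> :: real and X :: "nat \<Rightarrow> 'a \<Rightarrow> nat"
  assumes q_bounds: "0 < q" "q < 1"
    and theta_bounds: "0 \<le> \<theta>" "\<theta> \<le> 1"
    and X_measurable: "\<And>j. 1 \<le> j \<Longrightarrow> X j \<in> measurable M (count_space {0, 1})"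
    and cond_failure:
      "\<And>j i a. 1 \<le> j \<Longrightarrow> 1 \<le> i \<Longrightarrow> card {l \<in> {1..<j}. a l = 0} = i - 1 \<Longrightarrow>
        \<P>(\<omega> in M. \<forall>l\<in>{1..<j}. X l \<omega> = a l) > 0 \<Longrightarrow>
        \<P>(\<omega> in M. X j \<omega> = 0 \<bar> \<forall>l\<in>{1..<j}. X l \<omega> = a l) = 1 - \<theta> * q ^ (i - 1)"
    and cond_success:
      "\<And>j i a. 1 \<le> j \<Longrightarrow> 1 \<le> i \<Longrightarrow> card {l \<in> {1..<j}. a l = 0} = i - 1 \<Longrightarrow>
        \<P>(\<omega> in M. \<forall>l\<in>{1..<j}. X l \<omega> = a l) > 0 \<Longrightarrow>
        \<P>(\<omega> in M. X j \<omega> = 1 \<bar> \<forall>l\<in>{1..<j}. X l \<omega> = a l) = \<theta> * q ^ (i - 1)"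

text \<open>
  The infimum of the empty set in \<^typ>\<open>enat\<close> is \<open>\<infinity>\<close>, so a waiting time is infinite if the
  event does not occur. In \<open>success_time\<close> the set has at most one element.
\<close>

definition success_time :: "nat \<Rightarrow> (nat \<Rightarrow> nat) \<Rightarrow> enat" where
  "success_time k x = Inf {enat n | n. 1 \<le> n \<and> x n = 1 \<and> card {j \<in> {1..n}. x j = 1} = k}"

definition failure_run_time :: "nat \<Rightarrow> (nat \<Rightarrow> nat) \<Rightarrow> enat" where
  "failure_run_time k x = Inf {enat n | n. k \<le> n \<and> (\<forall>j\<in>{n - k + 1..n}. x j = 0)}"

definition W_S :: "nat \<Rightarrow> nat \<Rightarrow> (nat \<Rightarrow> nat) \<Rightarrow> enat" where
  "W_S k1 k2 x = min (success_time k1 x) (failure_run_time k2 x)"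

definition P1_S :: "'a measure \<Rightarrow> (nat \<Rightarrow> 'a \<Rightarrow> nat) \<Rightarrow> nat \<Rightarrow> nat \<Rightarrow> nat \<Rightarrow> real" where
  "P1_S M X k1 k2 n =
     \<P>(\<omega> in M. success_time k1 (\<lambda>j. X j \<omega>) = enat n \<and> failure_run_time k2 (\<lambda>j. X j \<omega>) > enat n)"

definition P0_S :: "'a measure \<Rightarrow> (nat \<Rightarrow> 'a \<Rightarrow> nat) \<Rightarrow> nat \<Rightarrow> nat \<Rightarrow> nat \<Rightarrow> real" where
  "P0_S M X k1 k2 n =
     \<P>(\<omega> in M. failure_run_time k2 (\<lambda>j. X j \<omega>) = enat n \<and> success_time k1 (\<lambda>j. X j \<omega>) > enat n)"

text \<open>
  An \<open>s\<close>-tuple is an extensional function on \<open>{1..s}\<close>; for \<open>s = 0\<close> there is exactly one.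
  The index sets below are finite, since the sums of the positive entries are prescribed.
\<close>

definition pos_tuples :: "nat \<Rightarrow> int \<Rightarrow> (nat \<Rightarrow> nat) set" where
  "pos_tuples s u = {x \<in> {1..s} \<rightarrow>\<^sub>E {1..}. int (\<Sum>j=1..s. x j) = u}"

definition bounded_pos_tuples :: "nat \<Rightarrow> nat \<Rightarrow> int \<Rightarrow> (nat \<Rightarrow> nat) set" where
  "bounded_pos_tuples k s v = {y \<in> pos_tuples s v. \<forall>j\<in>{1..s}. y j < k}"

definition G_bar :: "real \<Rightarrow> nat \<Rightarrow> int \<Rightarrow> int \<Rightarrow> nat \<Rightarrow> real" where
  "G_bar q k u v s =
     (\<Sum>(x, y) \<in> pos_tuples s u \<times> bounded_pos_tuples k (s - 1) v.
        q ^ (\<Sum>j=2..s. (\<Sum>l=1..j - 1. y l) * x j))"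

definition H_bar :: "real \<Rightarrow> nat \<Rightarrow> int \<Rightarrow> int \<Rightarrow> nat \<Rightarrow> real" where
  "H_bar q k u v s =
     (\<Sum>(x, y) \<in> pos_tuples s u \<times> bounded_pos_tuples k s v.
        q ^ (\<Sum>j=1..s. (\<Sum>l=1..j. y l) * x j))"

end

theory Submission
  imports Defs "HOL-Library.Sublist"
begin

text \<open>
  Whether either waiting time has elapsed by trial \<open>n\<close> is decided by the word of the first \<open>n\<close>
  outcomes: the success quota is still open iff the word has fewer than \<open>k1\<close> successes, and no
  failure run has occurred iff \<open>k2\<close> consecutive failures are not a factor of it. Comparing trials
  \<open>n - 1\<close> and \<open>n\<close> gives the words at which the game stops. On the success side they end in a
  success, contain exactly \<open>k1\<close> of them and have no long failure run
  (\<open>success_quota_first_iff\<close>). On the failure side they are \<open>u\<close> followed by \<open>k2\<close> failures, where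
  \<open>u\<close> is empty or ends in a success, has no long run and fewer than \<open>k1\<close> successes
  (\<open>failure_run_first_iff\<close>). Since a word ends in only one letter, the two ways to stop exclude
  each other, which gives the sum formula for the sooner waiting time (\<open>prob_W_S\<close>).

  The probability of a word is a product over its letters (\<open>prob_word_event\<close>). The \<open>j\<close>-th failure
  contributes \<open>1 - \<theta> q\<^sup>j\<^sup>-\<^sup>1\<close> wherever it stands; a success contributes \<open>\<theta>\<close> times \<open>q\<close> to the number
  of earlier failures. So all words with the same numbers of successes and failures share the
  power of \<open>\<theta>\<close> and the product of the \<open>1 - \<theta> q\<^sup>j\<^sup>-\<^sup>1\<close>, and what remains is \<open>q\<close> to the number of pairs
  of a failure and a later success (\<open>inversions\<close>). Failures after the last success create no such pair.

  It remains to sum \<open>q ^ inversions w\<close> over the words \<open>w\<close> that end in a success and have no long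
  failure run. Such a word splits in exactly one way into \<open>s\<close> blocks, each consisting of \<open>y j\<close>
  failures followed by \<open>x j\<close> successes, where only \<open>y 1\<close> may be \<open>0\<close> (\<open>bij_betw_block_word\<close>). The
  number of inversions is then \<open>\<Sum>j. (y 1 + \<dots> + y j) * x j\<close>. Words that begin with a failure
  (\<open>y 1 > 0\<close>) give the sum \<open>H_bar\<close>, those that begin with a success (\<open>y 1 = 0\<close>) give \<open>G_bar\<close>
  (\<open>sum_ended_words\<close>).
\<close>
section \<open>Outcome words\<close>

definition outcome_word :: "(nat \<Rightarrow> nat) \<Rightarrow> nat \<Rightarrow> bool list" where
  "outcome_word x n = map (\<lambda>j. x j = 1) [1..<Suc n]"

abbreviation successes :: "bool list \<Rightarrow> nat" where
  "successes w \<equiv> count_list w True"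

abbreviation failures :: "bool list \<Rightarrow> nat" where
  "failures w \<equiv> count_list w False"

abbreviation no_failure_run :: "nat \<Rightarrow> bool list \<Rightarrow> bool" where
  "no_failure_run k w \<equiv> \<not> sublist (replicate k False) w"

lemma outcome_word_0 [simp]: "outcome_word x 0 = []"
  by (simp add: outcome_word_def)

lemma outcome_word_Suc [simp]: "outcome_word x (Suc n) = outcome_word x n @ [x (Suc n) = 1]"
  by (simp add: outcome_word_def)

lemma length_outcome_word [simp]: "length (outcome_word x n) = n"
  by (simp add: outcome_word_def)

lemma nth_outcome_word: "i < n \<Longrightarrow> outcome_word x n ! i \<longleftrightarrow> x (Suc i) = 1"
  by (simp add: outcome_word_def del: upt_Suc)

lemma successes_plus_failures: "successes w + failures w = length w"
  by (induction w) auto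

lemma count_list_replicate: "count_list (replicate n a) b = (if a = b then n else 0)"
  by (induction n) auto

lemma no_failure_run_snoc_success:
  assumes "1 \<le> k"
  shows "no_failure_run k (w @ [True]) \<longleftrightarrow> no_failure_run k w"
proof -
  obtain m where "k = Suc m" using assms by (cases k) auto
  then have "\<not> suffix (replicate k False) (w @ [True])"
    by (simp add: replicate_append_same [symmetric] del: suffix_snoc)
  then show ?thesis by (simp only: sublist_snoc) auto
qed

lemma no_failure_run_append_successes:
  assumes "1 \<le> k"
  shows "no_failure_run k (w @ replicate a True) \<longleftrightarrow> no_failure_run k w"
proof (induction a)
  case (Suc a)
  have "w @ replicate (Suc a) True = (w @ replicate a True) @ [True]"
    by (simp add: replicate_append_same)
  then show ?case using no_failure_run_snoc_success [OF assms] Suc by metis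
qed simp

text \<open>
  The last letter of \<open>w\<close> stops the trailing run from extending into \<open>w\<close>, so the run has exactly
  length \<open>b\<close>.
\<close>
lemma suffix_failures_iff:
  assumes "w = [] \<or> last w"
  shows "suffix (replicate k False) (w @ replicate b False) \<longleftrightarrow> k \<le> b"
proof (induction b arbitrary: k)
  case 0
  then show ?case
    using assms by (cases w rule: rev_cases; cases k)
      (auto simp: replicate_append_same [symmetric] simp del: suffix_snoc)
next
  case (Suc b)
  then show ?case
    by (cases k) (auto simp: replicate_append_same [symmetric] append_assoc [symmetric]
        simp del: append_assoc suffix_snoc)
qed

text \<open>
  As the appended failures begin after a success or at the start of the word, they form a run of
  their own; it contains \<open>k\<close> consecutive failures iff its length is at least \<open>k\<close>.
\<close>
lemma no_failure_run_append_failures: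
  assumes "w = [] \<or> last w" "1 \<le> k"
  shows "no_failure_run k (w @ replicate b False) \<longleftrightarrow> no_failure_run k w \<and> b < k"
proof (induction b)
  case 0
  then show ?case using assms by auto
next
  case (Suc b)
  have eq: "w @ replicate (Suc b) False = (w @ replicate b False) @ [False]"
    by (simp add: replicate_append_same)
  have "suffix (replicate k False) ((w @ replicate b False) @ [False]) \<longleftrightarrow> k \<le> Suc b"
    using suffix_failures_iff [OF assms(1), of k "Suc b"] unfolding eq .
  then show ?case unfolding eq sublist_snoc using Suc by auto
qed

text \<open>
  A run that is completed by the last letter occupies the last \<open>k\<close> places. Its predecessor cannot
  be a failure, since then the run would have been complete one letter earlier.
\<close>
lemma first_failure_run_iff:
  assumes "1 \<le> k"
  shows "no_failure_run k v \<and> \<not> no_failure_run k (v @ [b]) \<longleftrightarrow>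
    (\<exists>u. v @ [b] = u @ replicate k False \<and> (u = [] \<or> last u) \<and> no_failure_run k u)"
    (is "?L \<longleftrightarrow> ?R")
proof
  obtain m where m: "k = Suc m" using assms by (cases k) auto
  have rep: "replicate k False = replicate m False @ [False]"
    by (simp add: m replicate_append_same)
  {
    assume L: ?L
    then have "suffix (replicate k False) (v @ [b])" by (simp only: sublist_snoc) auto
    then obtain u where u: "v @ [b] = u @ replicate k False" by (auto simp: suffix_def)
    have v: "v = u @ replicate m False"
      using arg_cong [OF u, of butlast] by (simp add: rep butlast_append)
    have "u = [] \<or> last u"
    proof (rule ccontr)
      assume "\<not> (u = [] \<or> last u)"
      then obtain u' where "u = u' @ [False]" by (metis append_butlast_last_id)
      then have "v = u' @ replicate k False" by (simp add: v m)
      then show False using L by auto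
    qed
    moreover have "no_failure_run k u" using L v by (auto simp: sublist_append)
    ultimately show ?R using u by blast
  }
  {
    assume ?R
    then obtain u where u: "v @ [b] = u @ replicate k False" "u = [] \<or> last u" "no_failure_run k u"
      by blast
    have v: "v = u @ replicate m False"
      using arg_cong [OF u(1), of butlast] by (simp add: rep butlast_append)
    have "no_failure_run k v"
      using no_failure_run_append_failures [OF u(2) assms, of m] u(3) by (simp add: v m)
    moreover have "\<not> no_failure_run k (v @ [b])" unfolding u(1) by auto
    ultimately show ?L ..
  }
qed

section \<open>The waiting times in terms of outcome words\<close>

text \<open>
  Waiting times are handled through the events that they exceed \<open>n\<close>: these also cover the value
  \<open>\<infinity>\<close> and depend on the first \<open>n\<close> outcomes only.
\<close>
lemma enat_less_Inf_iff: "enat n < Inf {enat m | m. P m} \<longleftrightarrow> (\<forall>m\<le>n. \<not> P m)"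
proof -
  have "Inf {enat m | m. P m} < enat (Suc n) \<longleftrightarrow> (\<exists>m\<le>n. P m)"
    by (auto simp: Inf_less_iff less_Suc_eq_le)
  moreover have "enat n < t \<longleftrightarrow> \<not> t < enat (Suc n)" for t
    by (cases t) auto
  ultimately show ?thesis by simp
qed

lemma enat_eq_Suc_iff: "t = enat (Suc n) \<longleftrightarrow> enat n < t \<and> \<not> enat (Suc n) < t"
  by (cases t) auto

lemma card_successes: "card {j \<in> {1..n}. x j = 1} = successes (outcome_word x n)"
proof (induction n)
  case (Suc n)
  have "{j \<in> {1..Suc n}. x j = 1} =
      (if x (Suc n) = 1 then insert (Suc n) {j \<in> {1..n}. x j = 1} else {j \<in> {1..n}. x j = 1})"
    by (auto simp: le_Suc_eq)
  then show ?case using Suc by simp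
qed simp

text \<open>
  The number of successes grows by at most one per trial, so it cannot pass \<open>k\<close> without a trial at
  which it becomes \<open>k\<close>, and this trial is a success.
\<close>
lemma less_success_time_iff:
  assumes "1 \<le> k"
  shows "enat n < success_time k x \<longleftrightarrow> successes (outcome_word x n) < k"
proof -
  let ?c = "\<lambda>n. successes (outcome_word x n)"
  have "(\<forall>m\<le>n. \<not> (1 \<le> m \<and> x m = 1 \<and> ?c m = k)) \<longleftrightarrow> ?c n < k"
  proof (induction n)
    case (Suc n)
    have "?c (Suc n) = ?c n + (if x (Suc n) = 1 then 1 else 0)" by simp
    moreover have "(\<forall>m\<le>Suc n. Q m) \<longleftrightarrow> (\<forall>m\<le>n. Q m) \<and> Q (Suc n)" for Q
      by (auto simp: le_Suc_eq)
    ultimately show ?case using Suc by simp linarith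
  qed (use assms in auto)
  then show ?thesis unfolding success_time_def enat_less_Inf_iff card_successes .
qed

lemma suffix_outcome_word_iff:
  "suffix (replicate k False) (outcome_word x m) \<longleftrightarrow> k \<le> m \<and> (\<forall>j\<in>{m - k + 1..m}. x j \<noteq> 1)"
proof (induction k arbitrary: m)
  case (Suc k)
  show ?case
  proof (cases m)
    case (Suc m')
    have "{Suc m' - Suc k + 1..Suc m'} = insert (Suc m') {m' - k + 1..m'}" if "k \<le> m'"
      using that by auto
    then show ?thesis
      using Suc.IH [of m'] unfolding Suc
      by (auto simp: replicate_append_same [symmetric] simp del: suffix_snoc)
  qed simp
qed simp

lemma less_failure_run_time_iff:
  assumes "\<forall>j\<ge>1. x j \<in> {0, 1}" "1 \<le> k"
  shows "enat n < failure_run_time k x \<longleftrightarrow> no_failure_run k (outcome_word x n)"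
proof -
  have zero: "x j = 0 \<longleftrightarrow> x j \<noteq> 1" if "1 \<le> j" for j using assms(1) that by auto
  have "(k \<le> m \<and> (\<forall>j\<in>{m - k + 1..m}. x j = 0)) \<longleftrightarrow>
      suffix (replicate k False) (outcome_word x m)" for m
    unfolding suffix_outcome_word_iff using zero by auto
  moreover have "(\<forall>m\<le>n. \<not> suffix (replicate k False) (outcome_word x m)) \<longleftrightarrow>
      no_failure_run k (outcome_word x n)"
  proof (induction n)
    case (Suc n)
    moreover have "(\<forall>m\<le>Suc n. Q m) \<longleftrightarrow> (\<forall>m\<le>n. Q m) \<and> Q (Suc n)" for Q
      by (auto simp: le_Suc_eq)
    ultimately show ?case by (simp add: sublist_snoc del: suffix_snoc) blast
  qed (use assms(2) in auto)
  ultimately show ?thesis unfolding failure_run_time_def enat_less_Inf_iff by simp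
qed

text \<open>
  The words with \<open>u\<close> successes and \<open>v\<close> failures at which a quota of \<open>u\<close> successes is reached before
  a run of \<open>k\<close> failures. They also occur as the part before the run in the words of the opposite
  outcome.
\<close>
definition ended_words :: "nat \<Rightarrow> nat \<Rightarrow> nat \<Rightarrow> bool list set" where
  "ended_words k u v =
     {w. w \<noteq> [] \<and> last w \<and> successes w = u \<and> failures w = v \<and> no_failure_run k w}"

definition failure_words :: "nat \<Rightarrow> nat \<Rightarrow> nat \<Rightarrow> bool list set" where
  "failure_words k1 k2 n =
     {u @ replicate k2 False |u. (u = [] \<or> last u) \<and> no_failure_run k2 u \<and> successes u < k1
        \<and> length u + k2 = n}"

lemma success_quota_first_iff:
  assumes "\<forall>j\<ge>1. x j \<in> {0, 1}" "1 \<le> k1" "1 \<le> k2" "k1 \<le> n"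
  shows "success_time k1 x = enat n \<and> enat n < failure_run_time k2 x \<longleftrightarrow>
    outcome_word x n \<in> ended_words k2 k1 (n - k1)"
proof -
  obtain m where m: "n = Suc m" using assms by (cases n) auto
  have "successes (outcome_word x n) + failures (outcome_word x n) = n"
    by (simp only: successes_plus_failures length_outcome_word)
  then show ?thesis
    using less_success_time_iff [OF assms(2), of _ x] less_failure_run_time_iff [OF assms(1,3)]
      assms(4)
    unfolding m enat_eq_Suc_iff ended_words_def by auto
qed

lemma failure_run_first_iff:
  assumes "\<forall>j\<ge>1. x j \<in> {0, 1}" "1 \<le> k1" "1 \<le> k2" "1 \<le> n"
  shows "failure_run_time k2 x = enat n \<and> enat n < success_time k1 x \<longleftrightarrow>
    (\<exists>u. outcome_word x n = u @ replicate k2 False \<and> (u = [] \<or> last u) \<and> no_failure_run k2 u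
        \<and> successes u < k1)"
proof -
  obtain m where m: "n = Suc m" using assms by (cases n) auto
  let ?v = "outcome_word x m" and ?b = "x (Suc m) = 1"
  have "failure_run_time k2 x = enat n \<longleftrightarrow> no_failure_run k2 ?v \<and> \<not> no_failure_run k2 (?v @ [?b])"
    unfolding m enat_eq_Suc_iff less_failure_run_time_iff [OF assms(1,3)] outcome_word_Suc ..
  also have "\<dots> \<longleftrightarrow> (\<exists>u. outcome_word x n = u @ replicate k2 False \<and> (u = [] \<or> last u)
      \<and> no_failure_run k2 u)"
    unfolding first_failure_run_iff [OF assms(3)] m outcome_word_Suc ..
  finally have "failure_run_time k2 x = enat n \<longleftrightarrow>
      (\<exists>u. outcome_word x n = u @ replicate k2 False \<and> (u = [] \<or> last u) \<and> no_failure_run k2 u)" .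
  moreover have "enat n < success_time k1 x \<longleftrightarrow> successes (outcome_word x n) < k1"
    by (rule less_success_time_iff [OF assms(2)])
  moreover have "successes (u @ replicate k2 False) = successes u" for u
    by (simp add: count_list_replicate)
  ultimately show ?thesis by metis
qed

lemma waiting_times_distinct:
  assumes "\<forall>j\<ge>1. x j \<in> {0, 1}" "1 \<le> k1" "1 \<le> k2" "1 \<le> n"
  shows "\<not> (success_time k1 x = enat n \<and> failure_run_time k2 x = enat n)"
proof -
  obtain m where m: "n = Suc m" using assms by (cases n) auto
  show ?thesis
    using less_success_time_iff [OF assms(2), of _ x] less_failure_run_time_iff [OF assms(1,3)]
      no_failure_run_snoc_success [OF assms(3), of "outcome_word x m"]
    unfolding m enat_eq_Suc_iff by (auto split: if_splits)
qed

section \<open>Decomposition of words into blocks\<close>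

primrec inversions :: "bool list \<Rightarrow> nat" where
  "inversions [] = 0"
| "inversions (b # w) = (if b then 0 else successes w) + inversions w"

text \<open>
  A failure in \<open>v\<close> precedes every success in \<open>w\<close>, which accounts for the product.
\<close>
lemma inversions_append:
  "inversions (v @ w) = inversions v + inversions w + failures v * successes w"
  by (induction v) auto

lemma inversions_replicate: "inversions (replicate n b) = 0"
  by (induction n) (auto simp: count_list_replicate)

text \<open>
  The recursion adds the block with the highest index at the end, so that the partial sums of \<open>y\<close>
  in the exponents of \<open>G_bar\<close> and \<open>H_bar\<close> are the numbers of failures of the prefixes.
\<close>
primrec block_word :: "(nat \<Rightarrow> nat) \<Rightarrow> (nat \<Rightarrow> nat) \<Rightarrow> nat \<Rightarrow> bool list" where
  "block_word x y 0 = []"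
| "block_word x y (Suc s) =
     block_word x y s @ replicate (y (Suc s)) False @ replicate (x (Suc s)) True"

lemma block_word_cong:
  "(\<And>j. j \<in> {1..s} \<Longrightarrow> x j = x' j \<and> y j = y' j) \<Longrightarrow> block_word x y s = block_word x' y' s"
  by (induction s) auto

lemma successes_block_word: "successes (block_word x y s) = (\<Sum>j=1..s. x j)"
  by (induction s) (auto simp: count_list_replicate)

lemma failures_block_word: "failures (block_word x y s) = (\<Sum>j=1..s. y j)"
  by (induction s) (auto simp: count_list_replicate)

lemma inversions_block_word:
  "inversions (block_word x y s) = (\<Sum>j=1..s. (\<Sum>l=1..j. y l) * x j)"
  by (induction s)
    (auto simp: inversions_append inversions_replicate count_list_replicate failures_block_word
      algebra_simps)

text \<open>
  The first block may have no failures, which makes room for the words that begin with a success.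
  An empty run in any later block would merge two runs of successes, and the decomposition would
  not be unique.
\<close>
definition admissible :: "nat \<Rightarrow> nat \<Rightarrow> (nat \<Rightarrow> nat) \<Rightarrow> (nat \<Rightarrow> nat) \<Rightarrow> bool" where
  "admissible k s x y \<longleftrightarrow> (\<forall>j\<in>{1..s}. 1 \<le> x j \<and> y j < k \<and> (2 \<le> j \<longrightarrow> 1 \<le> y j))"

lemma admissible_Suc:
  "admissible k (Suc s) x y \<longleftrightarrow>
    admissible k s x y \<and> 1 \<le> x (Suc s) \<and> y (Suc s) < k \<and> (1 \<le> s \<longrightarrow> 1 \<le> y (Suc s))"
  unfolding admissible_def by (auto simp: atLeastAtMostSuc_conv)

lemma block_word_last:
  assumes "admissible k s x y"
  shows "(s = 0 \<longleftrightarrow> block_word x y s = []) \<and> (block_word x y s = [] \<or> last (block_word x y s))"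
  using assms by (cases s) (auto simp: admissible_Suc)

lemma no_failure_run_block_word:
  assumes "admissible k s x y" "1 \<le> k"
  shows "no_failure_run k (block_word x y s)"
  using assms(1)
proof (induction s)
  case (Suc s)
  then have "no_failure_run k (block_word x y s @ replicate (y (Suc s)) False)"
    using no_failure_run_append_failures [of "block_word x y s" k] block_word_last [of k s x y]
      assms(2) by (auto simp: admissible_Suc)
  then show ?case
    using no_failure_run_append_successes [OF assms(2)] by (simp flip: append_assoc)
qed (use assms(2) in auto)

lemma trailing_run_unique:
  assumes "u @ replicate a c = u' @ replicate a' c"
    and "u = [] \<or> last u \<noteq> c" "u' = [] \<or> last u' \<noteq> c"
  shows "u = u' \<and> a = a'"
  using assms(1)
proof (induction a arbitrary: a')
  case 0
  then show ?case using assms(2,3) by (cases a') (auto split: if_splits)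
next
  case (Suc a)
  show ?case
  proof (cases a')
    case 0
    then show ?thesis using Suc.prems assms(2,3) by (auto split: if_splits)
  next
    case (Suc b)
    then have "u @ replicate a c = u' @ replicate b c"
      using Suc.prems by (simp add: replicate_append_same [symmetric] flip: append_assoc)
    then show ?thesis using Suc.IH Suc by simp
  qed
qed

lemma trailing_run_exists: "\<exists>u a. w = u @ replicate a c \<and> (u = [] \<or> last u \<noteq> c)"
proof (induction w rule: rev_induct)
  case (snoc b w)
  show ?case
  proof (cases "b = c")
    case True
    obtain u a where "w = u @ replicate a c" "u = [] \<or> last u \<noteq> c" using snoc by blast
    then have "w @ [b] = u @ replicate (Suc a) c" using True by (simp add: replicate_append_same)
    then show ?thesis using \<open>u = [] \<or> last u \<noteq> c\<close> by blast
  next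
    case False
    then show ?thesis by (intro exI [of _ "w @ [b]"] exI [of _ 0]) auto
  qed
qed simp

text \<open>
  The blocks can be read off from the right: the trailing successes give \<open>x s\<close>, the failures before
  them give \<open>y s\<close>, and what is left again ends in a success or is empty.
\<close>
lemma block_word_inject:
  assumes "admissible k s x y" "admissible k s' x' y'" "block_word x y s = block_word x' y' s'"
  shows "s = s' \<and> (\<forall>j\<in>{1..s}. x j = x' j \<and> y j = y' j)"
  using assms
proof (induction s arbitrary: s')
  case 0
  then show ?case using block_word_last [OF 0(2)] by auto
next
  case (Suc s)
  have "s' \<noteq> 0" using block_word_last [OF Suc.prems(1)] Suc.prems(3) by (cases s') simp_all
  then obtain t where t: "s' = Suc t" by (cases s') auto
  let ?w = "block_word x y s" and ?w' = "block_word x' y' t"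
  let ?u = "?w @ replicate (y (Suc s)) False" and ?u' = "?w' @ replicate (y' (Suc t)) False"
  have adm: "admissible k s x y" "admissible k t x' y'"
    and y: "1 \<le> s \<longrightarrow> 1 \<le> y (Suc s)" "1 \<le> t \<longrightarrow> 1 \<le> y' (Suc t)"
    using Suc.prems(1,2) unfolding t admissible_Suc by auto
  have "?u = [] \<or> last ?u \<noteq> True" using y(1) by (cases s) auto
  moreover have "?u' = [] \<or> last ?u' \<noteq> True" using y(2) by (cases t) auto
  ultimately have 1: "?u = ?u'" "x (Suc s) = x' (Suc t)"
    using trailing_run_unique [of ?u "x (Suc s)" True ?u' "x' (Suc t)"] Suc.prems(3) t by auto
  have 2: "?w = ?w'" "y (Suc s) = y' (Suc t)"
    using trailing_run_unique [OF 1(1)] block_word_last [OF adm(1)] block_word_last [OF adm(2)]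
    by auto
  have "s = t \<and> (\<forall>j\<in>{1..s}. x j = x' j \<and> y j = y' j)"
    by (rule Suc.IH [OF adm 2(1)])
  then show ?case using 1 2 t by (auto simp: le_Suc_eq)
qed

text \<open>
  Stripping the trailing successes and then the trailing failures leaves a shorter word of the same
  kind, to which the induction hypothesis applies.
\<close>
lemma block_word_exists:
  assumes "1 \<le> k" "no_failure_run k w" "w = [] \<or> last w"
  shows "\<exists>s x y. admissible k s x y \<and> w = block_word x y s"
  using assms(2,3)
proof (induction w rule: length_induct)
  case (1 w)
  show ?case
  proof (cases "w = []")
    case True
    then show ?thesis by (intro exI [of _ 0]) (auto simp: admissible_def)
  next
    case False
    obtain u a where u: "w = u @ replicate a True" "u = [] \<or> last u \<noteq> True"
      using trailing_run_exists [of w True] by blast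
    obtain w' b where w': "u = w' @ replicate b False" "w' = [] \<or> last w' \<noteq> False"
      using trailing_run_exists [of u False] by blast
    have a: "1 \<le> a" using u False 1(3) by (cases a) auto
    have "no_failure_run k u"
      using 1(2) u(1) no_failure_run_append_successes [OF assms(1)] by simp
    then have nr: "no_failure_run k w'" "b < k"
      using no_failure_run_append_failures [of w' k b] w' assms(1) by auto
    have "length w' < length w" using a u w' by simp
    then obtain s x y where s: "admissible k s x y" "w' = block_word x y s"
      using 1(1) nr w'(2) by blast
    \<comment> \<open>If \<open>w'\<close> is not empty, it ends in a success. With \<open>b = 0\<close> the maximal run of trailing successes
      of \<open>w\<close> would then be longer than \<open>a\<close>.\<close>
    have b: "1 \<le> s \<longrightarrow> 1 \<le> b"
      using block_word_last [OF s(1)] s(2) u(2) w' by (cases b) auto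
    let ?x = "x(Suc s := a)" and ?y = "y(Suc s := b)"
    have "block_word ?x ?y s = w'"
      unfolding s(2) by (rule block_word_cong) auto
    then have "w = block_word ?x ?y (Suc s)" by (simp add: u w')
    moreover have "admissible k (Suc s) ?x ?y"
      using s(1) a b nr unfolding admissible_Suc by (auto simp: admissible_def)
    ultimately show ?thesis by blast
  qed
qed

text \<open>
  The functions are extensional on \<open>{1..s}\<close>, like the tuples in \<open>pos_tuples\<close>, so that each tuple is
  represented once.
\<close>
definition block_tuples ::
    "nat \<Rightarrow> nat \<Rightarrow> nat \<Rightarrow> nat \<Rightarrow> ((nat \<Rightarrow> nat) \<times> (nat \<Rightarrow> nat)) set" where
  "block_tuples k u v s =
     {(x, y). x \<in> extensional {1..s} \<and> y \<in> extensional {1..s} \<and> admissible k s x y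
        \<and> (\<Sum>j=1..s. x j) = u \<and> (\<Sum>j=1..s. y j) = v}"

lemma bij_betw_block_word:
  assumes "1 \<le> k"
  shows "bij_betw (\<lambda>(s, x, y). block_word x y s) (SIGMA s:{1..u}. block_tuples k u v s)
    (ended_words k u v)"
  unfolding bij_betw_def
proof
  show "inj_on (\<lambda>(s, x, y). block_word x y s) (SIGMA s:{1..u}. block_tuples k u v s)"
  proof (rule inj_onI)
    fix p p'
    assume "p \<in> (SIGMA s:{1..u}. block_tuples k u v s)" "p' \<in> (SIGMA s:{1..u}. block_tuples k u v s)"
      and "(\<lambda>(s, x, y). block_word x y s) p = (\<lambda>(s, x, y). block_word x y s) p'"
    then obtain s x y s' x' y' where p: "p = (s, x, y)" "p' = (s', x', y')"
      and xy: "(x, y) \<in> block_tuples k u v s" "(x', y') \<in> block_tuples k u v s'"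
      and eq: "block_word x y s = block_word x' y' s'"
      by auto
    have *: "s = s' \<and> (\<forall>j\<in>{1..s}. x j = x' j \<and> y j = y' j)"
      using block_word_inject [OF _ _ eq, of k] xy by (auto simp: block_tuples_def)
    have "x = x'" "y = y'"
      using xy * by (auto simp: block_tuples_def intro: extensionalityI)
    then show "p = p'" using * p by simp
  qed
  show "(\<lambda>(s, x, y). block_word x y s) ` (SIGMA s:{1..u}. block_tuples k u v s) = ended_words k u v"
  proof (intro equalityI subsetI)
    fix w assume "w \<in> (\<lambda>(s, x, y). block_word x y s) ` (SIGMA s:{1..u}. block_tuples k u v s)"
    then obtain s x y where s: "1 \<le> s" "(x, y) \<in> block_tuples k u v s" "w = block_word x y s"
      by auto
    then have "admissible k s x y" by (simp add: block_tuples_def)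
    then show "w \<in> ended_words k u v"
      using s block_word_last [of k s x y] no_failure_run_block_word [of k s x y] assms
      by (auto simp: ended_words_def block_tuples_def successes_block_word failures_block_word)
  next
    fix w assume w: "w \<in> ended_words k u v"
    then obtain s x y where s: "admissible k s x y" "w = block_word x y s"
      using block_word_exists [OF assms, of w] by (auto simp: ended_words_def)
    let ?x = "restrict x {1..s}" and ?y = "restrict y {1..s}"
    have eq: "w = block_word ?x ?y s"
      unfolding s(2) by (rule block_word_cong) simp
    have "s \<noteq> 0" using w s by (auto simp: ended_words_def)
    moreover have "(\<Sum>j=1..s. ?x j) = u" "(\<Sum>j=1..s. ?y j) = v"
      using w unfolding eq ended_words_def
      by (simp_all add: successes_block_word failures_block_word)
    \<comment> \<open>Each block contains a success, hence \<open>s \<le> u\<close>.\<close>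
    moreover have "(\<Sum>j=1..s. 1) \<le> (\<Sum>j=1..s. x j)"
      by (rule sum_mono) (use s(1) in \<open>auto simp: admissible_def\<close>)
    moreover have "admissible k s ?x ?y" using s(1) by (simp add: admissible_def)
    ultimately have "(s, ?x, ?y) \<in> (SIGMA s:{1..u}. block_tuples k u v s)"
      by (auto simp: block_tuples_def)
    then show "w \<in> (\<lambda>(s, x, y). block_word x y s) ` (SIGMA s:{1..u}. block_tuples k u v s)"
      using eq by (intro image_eqI [of _ _ "(s, ?x, ?y)"]) auto
  qed
qed

lemma finite_words_of_length: "finite {w :: bool list. length w = n}"
  using finite_lists_length_eq [of "UNIV :: bool set" n] by simp

lemma finite_ended_words: "finite (ended_words k u v)"
proof (rule finite_subset)
  show "ended_words k u v \<subseteq> {w. length w = u + v}"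
    by (auto simp: ended_words_def simp flip: successes_plus_failures)
qed (rule finite_words_of_length)


section \<open>The sums G and H as generating functions of words\<close>

text \<open>
  Turns the tuple \<open>y\<^sub>1, \<dots>, y\<^sub>s\<^sub>-\<^sub>1\<close> of \<open>G_bar\<close> into the failure runs of \<open>s\<close> blocks of which the first
  has no failures.
\<close>
definition prepend_zero :: "nat \<Rightarrow> (nat \<Rightarrow> nat) \<Rightarrow> nat \<Rightarrow> nat" where
  "prepend_zero s y = (\<lambda>j\<in>{1..s}. if j = 1 then 0 else y (j - 1))"

lemma sum_prepend_zero:
  assumes "m \<le> s"
  shows "(\<Sum>l=1..m. prepend_zero s y l) = (\<Sum>l=1..m - 1. y l)"
  using assms
proof (induction m)
  case (Suc m)
  then show ?case by (cases m) (auto simp: prepend_zero_def)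
qed simp

lemma finite_block_tuples: "finite (block_tuples k u v s)"
proof (rule finite_subset)
  show "block_tuples k u v s \<subseteq> ({1..s} \<rightarrow>\<^sub>E {..u}) \<times> ({1..s} \<rightarrow>\<^sub>E {..v})"
    by (auto simp: block_tuples_def PiE_def extensional_def intro!: member_le_sum)
qed (intro finite_cartesian_product finite_PiE; simp)

text \<open>
  If all failure runs are nonempty, the conditions on block tuples are those of the index set of
  \<open>H_bar\<close>.
\<close>
lemma H_bar_eq:
  "H_bar q k (int u) (int v) s =
    (\<Sum>(x, y)\<in>{(x, y) \<in> block_tuples k u v s. \<forall>j\<in>{1..s}. 1 \<le> y j}.
       q ^ (\<Sum>j=1..s. (\<Sum>l=1..j. y l) * x j))"
proof -
  have "pos_tuples s (int u) \<times> bounded_pos_tuples k s (int v) =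
      {(x, y) \<in> block_tuples k u v s. \<forall>j\<in>{1..s}. 1 \<le> y j}"
    unfolding pos_tuples_def bounded_pos_tuples_def block_tuples_def admissible_def PiE_iff
      of_nat_eq_iff
    by auto
  then show ?thesis by (simp add: H_bar_def)
qed

text \<open>
  Prepending a zero to \<open>y\<close> and dropping it again are inverse to each other. The prepended zero
  shifts the partial sums by one index, and the summand for \<open>j = 1\<close> vanishes; this turns the
  exponent of \<open>G_bar\<close> into that of \<open>H_bar\<close>.
\<close>
lemma G_bar_eq:
  assumes "1 \<le> k" "1 \<le> s"
  shows "G_bar q k (int u) (int v) s =
    (\<Sum>(x, y)\<in>{(x, y) \<in> block_tuples k u v s. y 1 = 0}.
       q ^ (\<Sum>j=1..s. (\<Sum>l=1..j. y l) * x j))"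
  unfolding G_bar_def
proof (rule sum.reindex_bij_witness [where
      j = "\<lambda>(x, y). (x, prepend_zero s y)" and i = "\<lambda>(x, y). (x, \<lambda>j\<in>{1..s - 1}. y (Suc j))"],
    goal_cases)
  case (1 p)
  then obtain x y where p: "p = (x, y)" "y \<in> extensional {1..s - 1}"
    by (auto simp: bounded_pos_tuples_def pos_tuples_def PiE_iff)
  have "(\<lambda>j\<in>{1..s - 1}. prepend_zero s y (Suc j)) = y"
    by (rule extensionalityI [OF _ p(2)]) (auto simp: prepend_zero_def)
  then show ?case by (simp add: p)
next
  case (2 p)
  then obtain x y where p: "p = (x, y)" and x: "x \<in> pos_tuples s (int u)"
    and y: "\<And>j. j \<in> {1..s - 1} \<Longrightarrow> 1 \<le> y j \<and> y j < k" "(\<Sum>j=1..s - 1. y j) = v"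
    by (auto simp: bounded_pos_tuples_def pos_tuples_def PiE_iff simp flip: of_nat_sum)
  have "prepend_zero s y j < k \<and> (2 \<le> j \<longrightarrow> 1 \<le> prepend_zero s y j)" if "j \<in> {1..s}" for j
  proof (cases "j = 1")
    case False
    then have "j - 1 \<in> {1..s - 1}" using that by (cases j) auto
    from y(1) [OF this] show ?thesis using that False by (simp add: prepend_zero_def)
  qed (use that assms(1) in \<open>simp add: prepend_zero_def\<close>)
  then have "admissible k s x (prepend_zero s y)"
    using x by (auto simp: admissible_def pos_tuples_def PiE_iff)
  moreover have "x \<in> extensional {1..s}" "(\<Sum>j=1..s. x j) = u"
    using x by (auto simp: pos_tuples_def PiE_iff simp flip: of_nat_sum)
  moreover have "(\<Sum>j=1..s. prepend_zero s y j) = v"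
    using y(2) by (simp only: sum_prepend_zero [OF order.refl])
  moreover have "prepend_zero s y 1 = 0" "prepend_zero s y \<in> extensional {1..s}"
    using assms(2) by (auto simp: prepend_zero_def)
  ultimately show ?case by (simp add: p block_tuples_def)
next
  case (3 p)
  then obtain x y where p: "p = (x, y)" "y \<in> extensional {1..s}" "y 1 = 0"
    by (auto simp: block_tuples_def)
  have "prepend_zero s (\<lambda>j\<in>{1..s - 1}. y (Suc j)) = y"
    by (rule extensionalityI [OF _ p(2)]) (use p(3) in \<open>auto simp: prepend_zero_def\<close>)
  then show ?case by (simp add: p)
next
  case (4 p)
  then obtain x y where p: "p = (x, y)" "y \<in> extensional {1..s}" "y 1 = 0"
    and x: "x \<in> extensional {1..s}" "(\<Sum>j=1..s. x j) = u" and adm: "admissible k s x y"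
    and y: "(\<Sum>j=1..s. y j) = v"
    by (auto simp: block_tuples_def)
  let ?y = "\<lambda>j\<in>{1..s - 1}. y (Suc j)"
  have eq: "prepend_zero s ?y = y"
    by (rule extensionalityI [OF _ p(2)]) (use p(3) in \<open>auto simp: prepend_zero_def\<close>)
  have "(\<Sum>j=1..s - 1. ?y j) = v"
    using sum_prepend_zero [of s s ?y] y unfolding eq by simp
  moreover have "\<forall>j\<in>{1..s - 1}. 1 \<le> ?y j \<and> ?y j < k"
    using adm assms(2) by (auto simp: admissible_def)
  moreover have "\<forall>j\<in>{1..s}. 1 \<le> x j" using adm by (auto simp: admissible_def)
  ultimately show ?case
    using x by (auto simp: p bounded_pos_tuples_def pos_tuples_def PiE_iff simp del: of_nat_sum)
next
  case (5 p)
  obtain x y where p: "p = (x, y)" by (cases p)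
  have "(\<Sum>j=1..s. (\<Sum>l=1..j. prepend_zero s y l) * x j) =
      (\<Sum>j=1..s. (\<Sum>l=1..j - 1. y l) * x j)"
    by (rule sum.cong) (auto simp: sum_prepend_zero simp del: One_nat_def)
  also have "\<dots> = (\<Sum>j=2..s. (\<Sum>l=1..j - 1. y l) * x j)"
    by (rule sum.mono_neutral_right) auto
  finally show ?case by (simp add: p)
qed

lemma H_bar_plus_G_bar:
  assumes "1 \<le> k" "1 \<le> s"
  shows "H_bar q k (int u) (int v) s + G_bar q k (int u) (int v) s =
    (\<Sum>(x, y)\<in>block_tuples k u v s. q ^ (\<Sum>j=1..s. (\<Sum>l=1..j. y l) * x j))"
proof -
  have "{1..s} = insert 1 {2..s}" using assms(2) by auto
  then have "{(x, y) \<in> block_tuples k u v s. \<forall>j\<in>{1..s}. 1 \<le> y j} =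
      {(x, y) \<in> block_tuples k u v s. y 1 \<noteq> 0}"
    by (auto simp: block_tuples_def admissible_def)
  moreover have "sum f ({(x, y) \<in> block_tuples k u v s. y 1 \<noteq> 0} \<union> {(x, y) \<in> block_tuples k u v s. y 1 = 0})
      = sum f {(x, y) \<in> block_tuples k u v s. y 1 \<noteq> 0} + sum f {(x, y) \<in> block_tuples k u v s. y 1 = 0}"
    for f :: "_ \<Rightarrow> real"
    by (rule sum.union_disjoint) (auto intro: finite_subset [OF _ finite_block_tuples])
  moreover have "{(x, y) \<in> block_tuples k u v s. y 1 \<noteq> 0} \<union> {(x, y) \<in> block_tuples k u v s. y 1 = 0} =
      block_tuples k u v s"
    by auto
  ultimately show ?thesis
    unfolding H_bar_eq G_bar_eq [OF assms] by simp
qed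

lemma sum_ended_words:
  assumes "1 \<le> k"
  shows "(\<Sum>w\<in>ended_words k u v. q ^ inversions w) =
    (\<Sum>s=1..u. H_bar q k (int u) (int v) s + G_bar q k (int u) (int v) s)"
proof -
  have "(\<Sum>w\<in>ended_words k u v. q ^ inversions w) =
      (\<Sum>p\<in>(SIGMA s:{1..u}. block_tuples k u v s).
         q ^ inversions ((\<lambda>(s, x, y). block_word x y s) p))"
    by (rule sum.reindex_bij_betw [OF bij_betw_block_word [OF assms], symmetric])
  also have "\<dots> = (\<Sum>s=1..u. \<Sum>(x, y)\<in>block_tuples k u v s. q ^ inversions (block_word x y s))"
    by (subst sum.Sigma) (auto simp: finite_block_tuples split_def)
  also have "\<dots> = (\<Sum>s=1..u. H_bar q k (int u) (int v) s + G_bar q k (int u) (int v) s)"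
    by (rule sum.cong) (auto simp: H_bar_plus_G_bar [OF assms] inversions_block_word)
  finally show ?thesis .
qed

section \<open>Probabilities of words\<close>

definition word_weight :: "real \<Rightarrow> real \<Rightarrow> bool list \<Rightarrow> real" where
  "word_weight q \<theta> w =
     \<theta> ^ successes w * (\<Prod>j=1..failures w. 1 - \<theta> * q ^ (j - 1)) * q ^ inversions w"

text \<open>
  A further success is preceded by all the failures of \<open>w\<close>, and a further failure is number
  \<open>failures w + 1\<close>; so the factor is the conditional probability of the letter after \<open>w\<close>.
\<close>
lemma word_weight_snoc:
  "word_weight q \<theta> (w @ [b]) =
    word_weight q \<theta> w * (if b then \<theta> * q ^ failures w else 1 - \<theta> * q ^ failures w)"
  by (simp add: word_weight_def inversions_append power_add)

lemma outcome_word_eq_iff: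
  "outcome_word x (length w) = w \<longleftrightarrow> (\<forall>l\<in>{1..<Suc (length w)}. (x l = 1) = w ! (l - 1))"
proof -
  have "outcome_word x (length w) = w \<longleftrightarrow> (\<forall>i<length w. (x (Suc i) = 1) = w ! i)"
    unfolding list_eq_iff_nth_eq by (simp add: nth_outcome_word)
  also have "\<dots> \<longleftrightarrow> (\<forall>l\<in>{1..<Suc (length w)}. (x l = 1) = w ! (l - 1))"
  proof (rule iffI; intro ballI allI impI)
    fix i assume all: "\<forall>l\<in>{1..<Suc (length w)}. (x l = 1) = w ! (l - 1)" and i: "i < length w"
    from i have "Suc i \<in> {1..<Suc (length w)}" by simp
    from bspec [OF all this] show "(x (Suc i) = 1) = w ! i" by (simp only: diff_Suc_1)
  next
    fix l assume all: "\<forall>i<length w. (x (Suc i) = 1) = w ! i" and l: "l \<in> {1..<Suc (length w)}"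
    from l obtain i where i: "l = Suc i" "i < length w" by (cases l) auto
    from all [rule_format, OF i(2)] show "(x l = 1) = w ! (l - 1)" by (simp only: i(1) diff_Suc_1)
  qed
  finally show ?thesis .
qed

lemma card_failures: "card {l \<in> {1..<Suc (length w)}. \<not> w ! (l - 1)} = failures w"
proof -
  have "{l \<in> {1..<Suc (length w)}. \<not> w ! (l - 1)} = Suc ` {i. i < length w \<and> \<not> w ! i}"
  proof (intro equalityI subsetI)
    fix l assume "l \<in> {l \<in> {1..<Suc (length w)}. \<not> w ! (l - 1)}"
    then show "l \<in> Suc ` {i. i < length w \<and> \<not> w ! i}" by (cases l) auto
  qed auto
  then show ?thesis
    by (simp add: card_image count_list_eq_length_filter length_filter_conv_card)
qed

context q_geometric_trials
begin

lemma X_zero_one: "\<omega> \<in> space M \<Longrightarrow> 1 \<le> j \<Longrightarrow> X j \<omega> \<in> {0, 1}"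
  using measurable_space [OF X_measurable] by fastforce

lemma outcomes_zero_one: "\<omega> \<in> space M \<Longrightarrow> \<forall>j\<ge>1. X j \<omega> \<in> {0, 1}"
  using X_zero_one by simp

lemma X_events: "1 \<le> j \<Longrightarrow> {\<omega> \<in> space M. X j \<omega> = c} \<in> events"
proof -
  assume j: "1 \<le> j"
  have "{\<omega> \<in> space M. X j \<omega> = c} = X j -` ({c} \<inter> {0, 1}) \<inter> space M"
    using X_zero_one [OF _ j] by auto
  also have "\<dots> \<in> events" by (rule measurable_sets [OF X_measurable [OF j]]) auto
  finally show ?thesis .
qed

abbreviation word_event :: "nat \<Rightarrow> bool list \<Rightarrow> 'a set" where
  "word_event n w \<equiv> {\<omega> \<in> space M. outcome_word (\<lambda>j. X j \<omega>) n = w}"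

lemma word_event_snoc:
  "word_event (Suc n) (w @ [b]) = word_event n w \<inter> {\<omega> \<in> space M. X (Suc n) \<omega> = of_bool b}"
  using X_zero_one [of _ "Suc n"] by (cases b) fastforce+

lemma word_event_measurable: "word_event (length w) w \<in> events"
proof (induction w rule: rev_induct)
  case (snoc b w)
  then show ?case
    using X_events [of "Suc (length w)" "of_bool b"] by (simp add: word_event_snoc sets.Int del: outcome_word_Suc)
qed simp

text \<open>
  The chain rule for conditional probabilities, one letter at a time. If the prefix has
  probability \<open>0\<close>, the conditional probability says nothing, but then the extended word has
  probability and weight \<open>0\<close> as well.
\<close>
lemma prob_word_event: "prob (word_event (length w) w) = word_weight q \<theta> w"
proof (induction w rule: rev_induct)
  case Nil
  then show ?case by (simp add: word_weight_def prob_space)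
next
  case (snoc b w)
  let ?n = "length w" and ?E = "word_event (length w) w"
  let ?p = "if b then \<theta> * q ^ failures w else 1 - \<theta> * q ^ failures w"
  have "prob (word_event (Suc ?n) (w @ [b])) = prob ?E * ?p"
  proof (cases "prob ?E = 0")
    case True
    have "prob (word_event (Suc ?n) (w @ [b])) \<le> prob ?E"
      unfolding word_event_snoc by (rule finite_measure_mono [OF _ word_event_measurable]) auto
    then have "prob (word_event (Suc ?n) (w @ [b])) = 0"
      using True measure_nonneg [of M "word_event (Suc ?n) (w @ [b])"] by linarith
    then show ?thesis by (simp only: True mult_zero_left)
  next
    case False
    \<comment> \<open>The history \<open>w\<close> as a sequence of outcomes with indices from \<open>1\<close>, as the conditioning has it.\<close>
    define a where "a = (\<lambda>l. of_bool (w ! (l - 1)) :: nat)"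
    have E: "outcome_word (\<lambda>j. X j \<omega>) ?n = w \<longleftrightarrow> (\<forall>l\<in>{1..<Suc ?n}. X l \<omega> = a l)"
      if "\<omega> \<in> space M" for \<omega>
      unfolding outcome_word_eq_iff a_def
    proof (rule ball_cong [OF refl])
      fix l assume "l \<in> {1..<Suc ?n}"
      then have "X l \<omega> \<in> {0, 1}" using X_zero_one [OF that] by simp
      then show "(X l \<omega> = 1) = w ! (l - 1) \<longleftrightarrow> X l \<omega> = of_bool (w ! (l - 1))"
        by (cases "w ! (l - 1)") auto
    qed
    then have E': "?E = {\<omega> \<in> space M. \<forall>l\<in>{1..<Suc ?n}. X l \<omega> = a l}" by blast
    have pos: "\<P>(\<omega> in M. \<forall>l\<in>{1..<Suc ?n}. X l \<omega> = a l) > 0"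
      using False unfolding E' by (simp add: zero_less_measure_iff)
    have card: "card {l \<in> {1..<Suc ?n}. a l = 0} = Suc (failures w) - 1"
      using card_failures [of w] by (simp add: a_def)
    have "\<P>(\<omega> in M. X (Suc ?n) \<omega> = of_bool b \<bar> \<forall>l\<in>{1..<Suc ?n}. X l \<omega> = a l) = ?p"
      using cond_failure [OF _ _ card pos] cond_success [OF _ _ card pos] by (cases b) auto
    moreover have "{\<omega> \<in> space M. X (Suc ?n) \<omega> = of_bool b \<and> (\<forall>l\<in>{1..<Suc ?n}. X l \<omega> = a l)} =
        word_event (Suc ?n) (w @ [b])"
      unfolding word_event_snoc E' by blast
    ultimately show ?thesis
      unfolding cond_prob_def E' [symmetric] using False by (simp add: field_simps)
  qed
  then show ?case using snoc.IH by (simp add: word_weight_snoc del: outcome_word_Suc)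
qed

lemma outcome_word_in_eq_UN:
  "{\<omega> \<in> space M. outcome_word (\<lambda>j. X j \<omega>) n \<in> A} = (\<Union>w\<in>A. word_event n w)"
  by auto

lemma outcome_word_in_events:
  assumes "A \<subseteq> {w. length w = n}"
  shows "{\<omega> \<in> space M. outcome_word (\<lambda>j. X j \<omega>) n \<in> A} \<in> events"
  unfolding outcome_word_in_eq_UN
  using assms word_event_measurable finite_subset [OF assms finite_words_of_length]
  by (intro sets.finite_UN) auto

lemma prob_outcome_word_in:
  assumes "A \<subseteq> {w. length w = n}"
  shows "\<P>(\<omega> in M. outcome_word (\<lambda>j. X j \<omega>) n \<in> A) = (\<Sum>w\<in>A. word_weight q \<theta> w)"
proof -
  have "prob (\<Union>w\<in>A. word_event n w) = (\<Sum>w\<in>A. prob (word_event n w))"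
    using assms word_event_measurable finite_subset [OF assms finite_words_of_length]
    by (intro finite_measure_finite_Union) (auto simp: disjoint_family_on_def)
  also have "\<dots> = (\<Sum>w\<in>A. word_weight q \<theta> w)"
    by (rule sum.cong) (use assms prob_word_event in auto)
  finally show ?thesis unfolding outcome_word_in_eq_UN .
qed

section \<open>The distribution of the sooner waiting time\<close>

lemma success_event_eq:
  assumes "1 \<le> k1" "1 \<le> k2" "k1 \<le> n"
  shows "{\<omega> \<in> space M. success_time k1 (\<lambda>j. X j \<omega>) = enat n \<and>
        enat n < failure_run_time k2 (\<lambda>j. X j \<omega>)} =
      {\<omega> \<in> space M. outcome_word (\<lambda>j. X j \<omega>) n \<in> ended_words k2 k1 (n - k1)}"
  using success_quota_first_iff [OF outcomes_zero_one assms] by blast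

lemma failure_event_eq:
  assumes "1 \<le> k1" "1 \<le> k2" "1 \<le> n"
  shows "{\<omega> \<in> space M. failure_run_time k2 (\<lambda>j. X j \<omega>) = enat n \<and>
        enat n < success_time k1 (\<lambda>j. X j \<omega>)} =
      {\<omega> \<in> space M. outcome_word (\<lambda>j. X j \<omega>) n \<in> failure_words k1 k2 n}"
proof -
  have "(\<exists>u. outcome_word x n = u @ replicate k2 False \<and> (u = [] \<or> last u) \<and> no_failure_run k2 u
        \<and> successes u < k1) \<longleftrightarrow> outcome_word x n \<in> failure_words k1 k2 n" for x
  proof -
    have "length u + k2 = n" if "outcome_word x n = u @ replicate k2 False" for u
      using arg_cong [OF that, of length] by simp
    then show ?thesis unfolding failure_words_def mem_Collect_eq by blast
  qed
  then show ?thesis using failure_run_first_iff [OF outcomes_zero_one assms] by blast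
qed

lemma P1_S_eq_sum:
  assumes "1 \<le> k1" "1 \<le> k2" "k1 \<le> n"
  shows "P1_S M X k1 k2 n = (\<Sum>w\<in>ended_words k2 k1 (n - k1). word_weight q \<theta> w)"
  unfolding P1_S_def success_event_eq [OF assms]
  by (rule prob_outcome_word_in)
    (use assms(3) in \<open>auto simp: ended_words_def simp flip: successes_plus_failures\<close>)

lemma P0_S_eq_sum:
  assumes "1 \<le> k1" "1 \<le> k2" "1 \<le> n"
  shows "P0_S M X k1 k2 n = (\<Sum>w\<in>failure_words k1 k2 n. word_weight q \<theta> w)"
  unfolding P0_S_def failure_event_eq [OF assms]
  by (rule prob_outcome_word_in) (auto simp: failure_words_def)

lemma prob_W_S:
  assumes "1 \<le> k1" "1 \<le> k2" "1 \<le> n"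
  shows "\<P>(\<omega> in M. W_S k1 k2 (\<lambda>j. X j \<omega>) = enat n) = P1_S M X k1 k2 n + P0_S M X k1 k2 n"
proof -
  let ?x = "\<lambda>\<omega> j. X j \<omega>"
  let ?A = "{\<omega> \<in> space M. success_time k1 (?x \<omega>) = enat n \<and> enat n < failure_run_time k2 (?x \<omega>)}"
  let ?B = "{\<omega> \<in> space M. failure_run_time k2 (?x \<omega>) = enat n \<and> enat n < success_time k1 (?x \<omega>)}"
  have "W_S k1 k2 (?x \<omega>) = enat n \<longleftrightarrow>
      (success_time k1 (?x \<omega>) = enat n \<and> enat n < failure_run_time k2 (?x \<omega>)) \<or>
      (failure_run_time k2 (?x \<omega>) = enat n \<and> enat n < success_time k1 (?x \<omega>))"
    if "\<omega> \<in> space M" for \<omega>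
    using waiting_times_distinct [OF outcomes_zero_one [OF that] assms]
    unfolding W_S_def min_def by auto
  then have "{\<omega> \<in> space M. W_S k1 k2 (?x \<omega>) = enat n} = ?A \<union> ?B" by blast
  moreover have "?A \<in> events"
  proof (cases "k1 \<le> n")
    case True
    show ?thesis
      unfolding success_event_eq [OF assms(1,2) True]
      by (rule outcome_word_in_events)
        (use True in \<open>auto simp: ended_words_def simp flip: successes_plus_failures\<close>)
  next
    case False
    \<comment> \<open>Fewer than \<open>k1\<close> trials cannot contain \<open>k1\<close> successes.\<close>
    have "\<not> (success_time k1 (?x \<omega>) = enat n)" for \<omega>
    proof -
      have "successes (outcome_word (?x \<omega>) n) \<le> n"
        using count_le_length [of "outcome_word (?x \<omega>) n" True] by simp
      then have "enat n < success_time k1 (?x \<omega>)"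
        using False unfolding less_success_time_iff [OF assms(1)] by simp
      then show ?thesis by simp
    qed
    then show ?thesis by simp
  qed
  moreover have "?B \<in> events"
    unfolding failure_event_eq [OF assms]
    by (rule outcome_word_in_events) (auto simp: failure_words_def)
  moreover have "?A \<inter> ?B = {}" by auto
  ultimately show ?thesis
    unfolding P1_S_def P0_S_def by (simp add: finite_measure_Union)
qed

end

text \<open>
  Appended failures enlarge the product but leave the number of inversions unchanged. The case
  \<open>b = 0\<close> serves the success quota, \<open>b = k\<close> the failure run.
\<close>
lemma sum_word_weight_ended_words:
  assumes "1 \<le> k"
  shows "(\<Sum>w\<in>ended_words k u v. word_weight q \<theta> (w @ replicate b False)) =
    \<theta> ^ u * (\<Prod>j=1..v + b. 1 - \<theta> * q ^ (j - 1)) *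
    (\<Sum>s=1..u. H_bar q k (int u) (int v) s + G_bar q k (int u) (int v) s)"
proof -
  have "word_weight q \<theta> (w @ replicate b False) =
      \<theta> ^ u * (\<Prod>j=1..v + b. 1 - \<theta> * q ^ (j - 1)) * q ^ inversions w"
    if "w \<in> ended_words k u v" for w
    using that
    by (auto simp: ended_words_def word_weight_def inversions_append inversions_replicate
        count_list_replicate)
  then show ?thesis
    unfolding sum_ended_words [OF assms, symmetric] sum_distrib_left by (rule sum.cong [OF refl])
qed

lemma ended_words_no_failures:
  assumes "1 \<le> k" "1 \<le> u"
  shows "ended_words k u 0 = {replicate u True}"
proof (intro equalityI subsetI)
  fix w assume w: "w \<in> ended_words k u 0"
  then have "False \<notin> set w" by (auto simp: ended_words_def count_list_0_iff)
  then have "\<forall>b\<in>set w. b = True" by metis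
  then have "replicate (length w) True = w" by (rule replicate_length_same)
  moreover have "length w = u"
    using w by (auto simp: ended_words_def simp flip: successes_plus_failures)
  ultimately show "w \<in> {replicate u True}" by simp
next
  fix w assume "w \<in> {replicate u True}"
  then show "w \<in> ended_words k u 0"
    using assms no_failure_run_append_successes [OF assms(1), of "[]" u]
    by (auto simp: ended_words_def count_list_replicate)
qed

lemma failure_words_short:
  assumes "1 \<le> k1" "1 \<le> k2"
  shows "failure_words k1 k2 k2 = {replicate k2 False}"
  using assms by (auto simp: failure_words_def)

text \<open>
  For \<open>n > k2\<close> the part before the run is not empty, hence ends in a success; it is classified by
  its number \<open>i\<close> of successes.
\<close>
lemma failure_words_long:
  assumes "k2 < n"
  shows "failure_words k1 k2 n =
    (\<Union>i\<in>{1..min (n - k2) (k1 - 1)}. (\<lambda>u. u @ replicate k2 False) ` ended_words k2 i (n - k2 - i))"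
proof (intro equalityI subsetI)
  fix w assume "w \<in> failure_words k1 k2 n"
  then obtain u where u: "w = u @ replicate k2 False" "u = [] \<or> last u" "no_failure_run k2 u"
    "successes u < k1" "length u + k2 = n"
    by (auto simp: failure_words_def)
  have "u \<noteq> []" using u(5) assms by auto
  then have "True \<in> set u" using u(2) last_in_set by fastforce
  then have "1 \<le> successes u" using count_list_0_iff [of u True] by linarith
  moreover have "successes u + failures u = n - k2" using u(5) successes_plus_failures [of u] by simp
  ultimately have "u \<in> ended_words k2 (successes u) (n - k2 - successes u)"
    "successes u \<in> {1..min (n - k2) (k1 - 1)}"
    using u \<open>u \<noteq> []\<close> by (auto simp: ended_words_def)
  then show "w \<in> (\<Union>i\<in>{1..min (n - k2) (k1 - 1)}.
      (\<lambda>u. u @ replicate k2 False) ` ended_words k2 i (n - k2 - i))"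
    using u(1) by blast
next
  fix w assume "w \<in> (\<Union>i\<in>{1..min (n - k2) (k1 - 1)}.
      (\<lambda>u. u @ replicate k2 False) ` ended_words k2 i (n - k2 - i))"
  then obtain i u where i: "1 \<le> i" "i \<le> n - k2" "i \<le> k1 - 1"
    and u: "w = u @ replicate k2 False" "u \<in> ended_words k2 i (n - k2 - i)"
    by auto
  have "length u + k2 = n"
    using u(2) i assms successes_plus_failures [of u] by (simp add: ended_words_def)
  then show "w \<in> failure_words k1 k2 n"
    using u i by (auto simp: failure_words_def ended_words_def)
qed

lemma sum_failure_words:
  assumes "1 \<le> k2" "k2 < n"
  shows "(\<Sum>w\<in>failure_words k1 k2 n. word_weight q \<theta> w) =
    (\<Sum>i=1..min (n - k2) (k1 - 1).
       \<theta> ^ i * (\<Prod>j=1..n - i. 1 - \<theta> * q ^ (j - 1)) *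
       (\<Sum>s=1..i. H_bar q k2 (int i) (int (n - k2 - i)) s + G_bar q k2 (int i) (int (n - k2 - i)) s))"
proof -
  let ?I = "{1..min (n - k2) (k1 - 1)}" and ?f = "\<lambda>u. u @ replicate k2 False"
  have "(\<Sum>w\<in>failure_words k1 k2 n. word_weight q \<theta> w) =
      (\<Sum>i\<in>?I. \<Sum>w\<in>?f ` ended_words k2 i (n - k2 - i). word_weight q \<theta> w)"
    unfolding failure_words_long [OF assms(2)]
  proof (rule sum.UNION_disjoint)
    show "\<forall>i\<in>?I. \<forall>i'\<in>?I. i \<noteq> i' \<longrightarrow>
        ?f ` ended_words k2 i (n - k2 - i) \<inter> ?f ` ended_words k2 i' (n - k2 - i') = {}"
      by (auto simp: ended_words_def)
  qed (simp_all add: finite_ended_words)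
  also have "\<dots> = (\<Sum>i\<in>?I. \<Sum>u\<in>ended_words k2 i (n - k2 - i). word_weight q \<theta> (?f u))"
    by (rule sum.cong [OF refl], subst sum.reindex) (auto simp: inj_on_def)
  also have "\<dots> = (\<Sum>i\<in>?I. \<theta> ^ i * (\<Prod>j=1..n - i. 1 - \<theta> * q ^ (j - 1)) *
      (\<Sum>s=1..i. H_bar q k2 (int i) (int (n - k2 - i)) s + G_bar q k2 (int i) (int (n - k2 - i)) s))"
  proof (rule sum.cong [OF refl])
    fix i assume "i \<in> ?I"
    then have "n - k2 - i + k2 = n - i" using assms by auto
    then show "(\<Sum>u\<in>ended_words k2 i (n - k2 - i). word_weight q \<theta> (?f u)) =
        \<theta> ^ i * (\<Prod>j=1..n - i. 1 - \<theta> * q ^ (j - 1)) *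
        (\<Sum>s=1..i. H_bar q k2 (int i) (int (n - k2 - i)) s + G_bar q k2 (int i) (int (n - k2 - i)) s)"
      using sum_word_weight_ended_words [OF assms(1), where u = i and v = "n - k2 - i" and b = k2] by simp
  qed
  finally show ?thesis .
qed

theorem theorem4p1:
  fixes M :: "'a measure" and q \<theta> :: real and X :: "nat \<Rightarrow> 'a \<Rightarrow> nat" and k1 k2 :: nat
  assumes "q_geometric_trials M q \<theta> X"
    and "1 \<le> k1" and "1 \<le> k2"
  shows "(\<forall>n\<ge>min k1 k2.
            \<P>(\<omega> in M. W_S k1 k2 (\<lambda>j. X j \<omega>) = enat n) = P1_S M X k1 k2 n + P0_S M X k1 k2 n)
       \<and> P1_S M X k1 k2 k1 = \<theta> ^ k1
       \<and> P0_S M X k1 k2 k2 = (\<Prod>j=1..k2. 1 - \<theta> * q ^ (j - 1))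
       \<and> (\<forall>n>k1. P1_S M X k1 k2 n =
            \<theta> ^ k1 * (\<Prod>j=1..n - k1. 1 - \<theta> * q ^ (j - 1)) *
            (\<Sum>s=1..k1. H_bar q k2 (int k1) (int n - int k1) s + G_bar q k2 (int k1) (int n - int k1) s))
       \<and> (\<forall>n>k2. P0_S M X k1 k2 n =
            (\<Sum>i=1..min (n - k2) (k1 - 1).
               \<theta> ^ i * (\<Prod>j=1..n - i. 1 - \<theta> * q ^ (j - 1)) *
               (\<Sum>s=1..i. G_bar q k2 (int i) (int n - int k2 - int i) s
                         + H_bar q k2 (int i) (int n - int k2 - int i) s)))"
proof -
  interpret q_geometric_trials M q \<theta> X by (rule assms(1))
  note k = assms(2,3)
  have "P1_S M X k1 k2 k1 = \<theta> ^ k1"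
    using P1_S_eq_sum [OF k order.refl] ended_words_no_failures [OF k(2,1)]
    by (simp add: word_weight_def inversions_replicate count_list_replicate)
  moreover have "P0_S M X k1 k2 k2 = (\<Prod>j=1..k2. 1 - \<theta> * q ^ (j - 1))"
    using P0_S_eq_sum [OF k k(2)] failure_words_short [OF k]
    by (simp add: word_weight_def inversions_replicate count_list_replicate)
  moreover have "P1_S M X k1 k2 n = \<theta> ^ k1 * (\<Prod>j=1..n - k1. 1 - \<theta> * q ^ (j - 1)) *
      (\<Sum>s=1..k1. H_bar q k2 (int k1) (int n - int k1) s + G_bar q k2 (int k1) (int n - int k1) s)"
    if "k1 < n" for n
    using P1_S_eq_sum [OF k, of n] sum_word_weight_ended_words [OF k(2), where u = k1 and v = "n - k1" and b = 0]
      that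
    by (simp add: of_nat_diff)
  moreover have "P0_S M X k1 k2 n =
      (\<Sum>i=1..min (n - k2) (k1 - 1).
         \<theta> ^ i * (\<Prod>j=1..n - i. 1 - \<theta> * q ^ (j - 1)) *
         (\<Sum>s=1..i. G_bar q k2 (int i) (int n - int k2 - int i) s
                   + H_bar q k2 (int i) (int n - int k2 - int i) s))"
    if "k2 < n" for n
  proof -
    have "P0_S M X k1 k2 n = (\<Sum>w\<in>failure_words k1 k2 n. word_weight q \<theta> w)"
      by (rule P0_S_eq_sum [OF k]) (use that in simp)
    also have "\<dots> = (\<Sum>i=1..min (n - k2) (k1 - 1).
         \<theta> ^ i * (\<Prod>j=1..n - i. 1 - \<theta> * q ^ (j - 1)) *
         (\<Sum>s=1..i. G_bar q k2 (int i) (int n - int k2 - int i) s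
                   + H_bar q k2 (int i) (int n - int k2 - int i) s))"
      unfolding sum_failure_words [OF k(2) that]
      by (rule sum.cong) (use that in \<open>auto simp: of_nat_diff add.commute diff_diff_eq\<close>)
    finally show ?thesis .
  qed
  ultimately show ?thesis using prob_W_S [OF k] k by simp
qed

end
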